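(* Suppose a particle with initial slope $s$ (and any bomb) tunnels. Then its limiting path can be contained in at most two bands: there is some $r$ such that all walls it collides with outside a disc of radius $r$ are contained in a union of at most two bands. If two bands are required (i.e. no matter what finite $r$ is used, a single band does not suffice), then the two bands are directly opposite one another, with opposite directions (the directions of the rays defining them differ by an angle of $\pi$), and the slope of each band is equal to $s$.
   Context: Dynamics. The plane is covered by the unit square grid. The walls are the unit-length edges joining adjacent points of $\mathbb{Z}^2$ (each horizontal or vertical); the corners are the points of $\mathbb{Z}^2$. Initially every wall is solid. A bomb is a finite pattern of walls containing one marked horizontal wall together with finitely many (possibly zero) other walls. A particle starts at a given point with initial direction up and to the right with slope $s>0$. It moves in a straight line until it collides with a solid wall; it then reflects off, preserving the angle of incidence, and permanently erases all the walls obtained by moving the bomb by a rotation (and translation) so that the marked wall overlays the wall just hit and the particle is hitting the marked wall from below relative to the bomb. It passes freely through erased walls. If it reaches a corner it stops. Tunnels. A band is the set of points of the plane within a given finite distance of some ray $\ell$; its direction is that of $\ell$, and its slope is understood as the absolute value of the slope of $\ell$. A particle tunnels if it runs infinitely (without hitting a corner) and, for some $r$, every wall it collides with outside a disc of radius $r$ is contained in a finite union of bands. *)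

theory Defs
  imports "HOL-Analysis.Analysis"
begin

section \<open>Walls and bombs\<close>

text \<open>The plane is the type \<^typ>\<open>complex\<close>; a wall is a closed unit segment, as a set of points.\<close>

definition corners :: "complex set" where
  "corners = {z. Re z \<in> \<int> \<and> Im z \<in> \<int>}"

definition hwalls :: "complex set set" where
  "hwalls = {closed_segment a (a + 1) | a. a \<in> corners}"

definition vwalls :: "complex set set" where
  "vwalls = {closed_segment a (a + \<i>) | a. a \<in> corners}"

definition walls :: "complex set set" where
  "walls = hwalls \<union> vwalls"

text \<open>The marked wall \<open>m\<close> is itself a member of the pattern \<open>B\<close>, so a wall that is hit is
  always erased.\<close>

definition bomb :: "complex set \<Rightarrow> complex set set \<Rightarrow> bool" where
  "bomb m B \<longleftrightarrow> m \<in> hwalls \<and> m \<in> B \<and> B \<subseteq> walls \<and> finite B"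

text \<open>The walls erased when a particle with incoming velocity \<open>v\<close> hits the wall \<open>w\<close>. A rotation
  followed by a translation is \<open>z \<mapsto> c * z + d\<close> with \<open>norm c = 1\<close>, and \<open>v / c\<close> is the incoming
  velocity seen from the unrotated bomb: it points upwards iff the marked wall is hit from below.
  These conditions determine \<open>c\<close> and \<open>d\<close>.\<close>

definition blast_area ::
  "complex set \<Rightarrow> complex set set \<Rightarrow> complex set \<Rightarrow> complex \<Rightarrow> complex set set" where
  "blast_area m B w v =
     {(\<lambda>z. c * z + d) ` b | b c d.
        b \<in> B \<and> norm c = 1 \<and> (\<lambda>z. c * z + d) ` m = w \<and> Im (v / c) > 0}"

section \<open>Dynamics\<close>

datatype state = State (pos: complex) (vel: complex) (solid: "complex set set")

definition reflect :: "complex set \<Rightarrow> complex \<Rightarrow> complex" where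
  "reflect w v = (if w \<in> hwalls then cnj v else - cnj v)"

text \<open>\<open>free_flight \<sigma> t\<close>: the particle meets neither a solid wall nor a corner strictly between
  the times \<open>0\<close> and \<open>t\<close>. Time \<open>0\<close> is excluded, because after a collision the particle is located
  on the wall it has just hit; accordingly, whatever the starting point lies on does not count as
  being hit.\<close>

definition free_flight :: "state \<Rightarrow> real \<Rightarrow> bool" where
  "free_flight \<sigma> t \<longleftrightarrow>
     (\<forall>t'. 0 < t' \<and> t' < t \<longrightarrow> pos \<sigma> + of_real t' * vel \<sigma> \<notin> \<Union> (solid \<sigma>) \<union> corners)"

inductive collides ::
  "complex set \<Rightarrow> complex set set \<Rightarrow> state \<Rightarrow> complex set \<Rightarrow> state \<Rightarrow> bool"
  for m B where
  "\<lbrakk>0 < t; free_flight \<sigma> t; q = pos \<sigma> + of_real t * vel \<sigma>; q \<notin> corners; w \<in> solid \<sigma>; q \<in> w\<rbrakk>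
   \<Longrightarrow> collides m B \<sigma> w
         (State q (reflect w (vel \<sigma>)) (solid \<sigma> - blast_area m B w (vel \<sigma>)))"

inductive reachable ::
  "complex set \<Rightarrow> complex set set \<Rightarrow> real \<Rightarrow> complex \<Rightarrow> state \<Rightarrow> bool"
  for m B s p where
  start: "reachable m B s p (State p (Complex 1 s) walls)"
| bounce: "reachable m B s p \<sigma> \<Longrightarrow> collides m B \<sigma> w \<sigma>' \<Longrightarrow> reachable m B s p \<sigma>'"

text \<open>Every wall is hit at most once, so collisions cannot accumulate in finite time, and hitting
  a corner is the only way in which a particle can stop.\<close>

definition hits_corner :: "state \<Rightarrow> bool" where
  "hits_corner \<sigma> \<longleftrightarrow>
     (\<exists>t>0. free_flight \<sigma> t \<and> pos \<sigma> + of_real t * vel \<sigma> \<in> corners)"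

definition runs_infinitely ::
  "complex set \<Rightarrow> complex set set \<Rightarrow> real \<Rightarrow> complex \<Rightarrow> bool" where
  "runs_infinitely m B s p \<longleftrightarrow> (\<forall>\<sigma>. reachable m B s p \<sigma> \<longrightarrow> \<not> hits_corner \<sigma>)"

definition hit_walls ::
  "complex set \<Rightarrow> complex set set \<Rightarrow> real \<Rightarrow> complex \<Rightarrow> complex set set" where
  "hit_walls m B s p = {w. \<exists>\<sigma> \<sigma>'. reachable m B s p \<sigma> \<and> collides m B \<sigma> w \<sigma>'}"

section \<open>Bands and tunnelling\<close>

text \<open>A band is given by its defining ray (base point and unit direction vector) and its
  radius.\<close>

datatype band = Band (base: complex) (direction: complex) (radius: real)

definition bands :: "band set" where
  "bands = {b. norm (direction b) = 1 \<and> 0 \<le> radius b}"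

definition ray :: "band \<Rightarrow> complex set" where
  "ray b = {base b + of_real t * direction b | t. 0 \<le> t}"

definition region :: "band \<Rightarrow> complex set" where
  "region b = {z. \<exists>y\<in>ray b. dist z y \<le> radius b}"

text \<open>For a vertical band this is \<open>0\<close> by the convention \<open>x / 0 = 0\<close>, hence also different from any
  slope \<open>s > 0\<close>.\<close>

definition slope :: "band \<Rightarrow> real" where
  "slope b = \<bar>Im (direction b) / Re (direction b)\<bar>"

definition confined_outside ::
  "complex set \<Rightarrow> complex set set \<Rightarrow> real \<Rightarrow> complex \<Rightarrow> complex set \<Rightarrow> band set \<Rightarrow> bool" where
  "confined_outside m B s p D bs \<longleftrightarrow>
     (\<forall>w\<in>hit_walls m B s p. w \<inter> D = {} \<longrightarrow> w \<subseteq> (\<Union>b\<in>bs. region b))"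

definition tunnels ::
  "complex set \<Rightarrow> complex set set \<Rightarrow> real \<Rightarrow> complex \<Rightarrow> bool" where
  "tunnels m B s p \<longleftrightarrow>
     runs_infinitely m B s p \<and>
     (\<exists>c r bs. finite bs \<and> bs \<subseteq> bands \<and> confined_outside m B s p (cball c r) bs)"

end

theory Submission
  imports Defs
begin

text \<open>Outside a large disc the particle, and not only the walls it hits, stays close to the
  given rays: only walls close to hit walls are ever erased, and all other walls are barriers.
  Collisions inside a fixed disc occur only finitely often, because a wall that is hit is erased.
  Hence from some time on the particle can change from one ray to another only by crossing the disc
  in a straight line, with velocity \<open>v\<close> say; as both ends of a long chord are close to rays, these
  rays point in the directions \<open>- v\<close> and \<open>v\<close>. So only two opposite rays of slope \<open>s\<close> can be
  visited alternately.\<close>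

section \<open>Tubes around rays\<close>

text \<open>Up to a change of radius these are the bands with direction \<open>u\<close>, but being defined by a
  closed condition on the single point \<open>norm z *\<^sub>R u\<close> of the ray they are easier to compare.\<close>

definition tube :: "complex \<Rightarrow> real \<Rightarrow> complex set" where
  "tube u \<rho> = {z. norm (z - norm z *\<^sub>R u) \<le> \<rho>}"

lemma closed_tube: "closed (tube u \<rho>)"
  unfolding tube_def by (intro closed_Collect_le continuous_intros)

lemma tube_mono: "z \<in> tube u \<rho> \<Longrightarrow> \<rho> \<le> \<rho>' \<Longrightarrow> z \<in> tube u \<rho>'"
  by (simp add: tube_def)

text \<open>The norm is 1-Lipschitz and \<open>t *\<^sub>R u\<close> has norm \<open>t\<close>, so
  replacing the parameter \<open>t\<close> by \<open>norm z\<close> costs at most another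
  \<open>r\<close>.\<close>

lemma near_ray_in_tube:
  assumes "norm u = 1" "0 \<le> t" "norm (z - t *\<^sub>R u) \<le> r"
  shows "z \<in> tube u (2 * r)"
proof -
  have "norm (t *\<^sub>R u) = t" using assms by simp
  then have "\<bar>t - norm z\<bar> \<le> r"
    using assms(3) norm_triangle_ineq3[of "t *\<^sub>R u" z] by (simp add: norm_minus_commute)
  then have "norm ((t - norm z) *\<^sub>R u) \<le> r" using assms by simp
  moreover have "z - norm z *\<^sub>R u = (z - t *\<^sub>R u) + (t - norm z) *\<^sub>R u"
    by (simp add: algebra_simps)
  ultimately have "norm (z - norm z *\<^sub>R u) \<le> r + r"
    using assms(3) norm_triangle_mono by metis
  then show ?thesis by (simp add: tube_def)
qed

text \<open>Both the point and its norm change by at most \<open>d\<close>, which accounts for the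
  factor 2.\<close>

lemma tube_thicken:
  assumes "z \<in> tube u \<rho>" "norm u = 1" "dist z' z \<le> d"
  shows "z' \<in> tube u (\<rho> + 2 * d)"
proof -
  have "norm (z' - z) \<le> d" using assms by (simp add: dist_norm)
  moreover from this have "norm ((norm z - norm z') *\<^sub>R u) \<le> d"
    using assms norm_triangle_ineq3[of z z'] by (simp add: norm_minus_commute)
  moreover have "norm (z - norm z *\<^sub>R u) \<le> \<rho>" using assms by (simp add: tube_def)
  moreover have "z' - norm z' *\<^sub>R u
      = (z' - z) + ((z - norm z *\<^sub>R u) + (norm z - norm z') *\<^sub>R u)"
    by (simp add: algebra_simps)
  ultimately have "norm (z' - norm z' *\<^sub>R u) \<le> d + (\<rho> + d)"
    using norm_triangle_mono by metis
  then show ?thesis by (simp add: tube_def)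
qed

text \<open>The points \<open>norm z *\<^sub>R u\<close> and \<open>norm z *\<^sub>R u'\<close> are
  \<open>norm z * dist u u'\<close> apart and both close to \<open>z\<close>. Hence tubes with
  different directions meet only in a bounded set.\<close>

lemma tubes_diverge:
  assumes "z \<in> tube u a" "z \<in> tube u' b"
  shows "norm z * dist u u' \<le> a + b"
proof -
  have "norm (norm z *\<^sub>R (u - u')) = norm ((z - norm z *\<^sub>R u') - (z - norm z *\<^sub>R u))"
    by (simp add: algebra_simps)
  also have "\<dots> \<le> b + a"
    by (rule order_trans[OF norm_triangle_ineq4 add_mono]) (use assms in \<open>simp_all add: tube_def\<close>)
  finally show ?thesis by (simp add: dist_norm)
qed

text \<open>A tube that is wide enough swallows a given disc; this is how the exceptional disc of a
  confinement is removed later.\<close>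

lemma cball_in_tube:
  assumes "norm u = 1" "norm z \<le> r"
  shows "z \<in> tube u (2 * r)"
  using near_ray_in_tube[of u 0 z r] assms by simp

text \<open>Moving the base point to the origin costs \<open>norm (base b)\<close>, and
  \<open>near_ray_in_tube\<close> then doubles the radius.\<close>

lemma region_subset_tube:
  assumes "b \<in> bands"
  shows "region b \<subseteq> tube (direction b) (2 * (radius b + norm (base b)))"
proof
  fix z assume "z \<in> region b"
  then obtain t where t: "0 \<le> t" "dist z (base b + of_real t * direction b) \<le> radius b"
    by (auto simp: region_def ray_def)
  have "norm (z - t *\<^sub>R direction b)
      = norm ((z - (base b + of_real t * direction b)) + base b)"
    by (simp add: scaleR_conv_of_real algebra_simps)
  also have "\<dots> \<le> radius b + norm (base b)"
    using t(2) norm_triangle_mono by (metis dist_norm order_refl)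
  finally show "z \<in> tube (direction b) (2 * (radius b + norm (base b)))"
    using assms t near_ray_in_tube[of "direction b" t z "radius b + norm (base b)"]
    by (simp add: bands_def)
qed

lemma tube_subset_region: "tube u \<rho> \<subseteq> region (Band 0 u \<rho>)"
proof
  fix z assume "z \<in> tube u \<rho>"
  then show "z \<in> region (Band 0 u \<rho>)"
    unfolding region_def ray_def
    by (auto simp: tube_def dist_norm scaleR_conv_of_real intro!: exI[of _ "norm z"])
qed

section \<open>Straight segments between far points of finitely many tubes\<close>

lemma finite_uniformly_separated:
  fixes W :: "'a::metric_space set"
  assumes "finite W"
  obtains \<delta> where "0 < \<delta>" "\<And>u u'. u \<in> W \<Longrightarrow> u' \<in> W \<Longrightarrow> u \<noteq> u' \<Longrightarrow> \<delta> \<le> dist u u'"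
proof -
  have "finite {dist u u' |u u'. u \<in> W \<and> u' \<in> W \<and> u \<noteq> u'}" (is "finite ?S")
    by (rule finite_subset[of _ "(\<lambda>(u, u'). dist u u') ` (W \<times> W)"]) (auto simp: assms)
  \<comment> \<open>The extra element 1 keeps the set nonempty when \<open>W\<close> has at most one
    element.\<close>
  then have "0 < Min (insert 1 ?S)" by (subst Min_gr_iff) auto
  moreover have "Min (insert 1 ?S) \<le> dist u u'" if "u \<in> W" "u' \<in> W" "u \<noteq> u'" for u u'
    using \<open>finite ?S\<close> that by (intro Min_le) auto
  ultimately show ?thesis using that by blast
qed

text \<open>Far from the origin the tubes are disjoint closed sets, so a connected segment that
  stays there cannot leave its tube. A segment that comes near the origin has its two ends close to
  the rays from the origin in the directions \<open>- sgn v\<close> and \<open>sgn v\<close>, and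
  far out this identifies \<open>u\<close> and \<open>u'\<close>.\<close>

lemma far_segment_in_tubes:
  assumes "finite U" "finite V" and U: "\<And>u. u \<in> U \<Longrightarrow> norm u = 1" and "0 \<notin> V"
  obtains Q where "\<And>x v t u u'. \<lbrakk>v \<in> V; 0 \<le> t; u \<in> U; u' \<in> U; Q < norm x;
      Q < norm (x + of_real t * v); x \<in> tube u \<rho>; x + of_real t * v \<in> tube u' \<rho>;
      closed_segment x (x + of_real t * v) \<subseteq> (\<Union>u\<in>U. tube u \<rho>)\<rbrakk>
    \<Longrightarrow> u' = u \<or> u' = sgn v \<and> u = - sgn v"
proof -
  \<comment> \<open>The directions of the velocities and their negatives are included, so that one
    \<open>\<delta>\<close> also separates them from the directions in \<open>U\<close>.\<close>
  define W where "W = U \<union> sgn ` V \<union> uminus ` sgn ` V"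
  have "finite W" using assms by (simp add: W_def)
  then obtain \<delta> where \<delta>: "0 < \<delta>"
    and sep: "\<And>u u'. u \<in> W \<Longrightarrow> u' \<in> W \<Longrightarrow> u \<noteq> u' \<Longrightarrow> \<delta> \<le> dist u u'"
    by (rule finite_uniformly_separated) blast
  \<comment> \<open>By \<open>tubes_diverge\<close>, a point that is far enough out determines the
    direction of its tube.\<close>
  have same: "u = u'" if "u \<in> W" "u' \<in> W" "z \<in> tube u a" "z \<in> tube u' b" "a + b < \<delta> * norm z"
    for u u' z a b
  proof (rule ccontr)
    assume "u \<noteq> u'"
    then have "\<delta> * norm z \<le> norm z * dist u u'"
      using sep[OF that(1,2)] mult_right_mono[of \<delta> "dist u u'" "norm z"] by (simp add: mult.commute)
    then show False using tubes_diverge[OF that(3,4)] that(5) by linarith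
  qed
  \<comment> \<open>Beyond \<open>Q\<close>, tubes of radius \<open>\<rho>\<close> with different
    directions in \<open>W\<close> are disjoint; beyond \<open>Q'\<close>, so are a tube of radius
    \<open>2 * Q\<close> and one of radius \<open>\<rho>\<close>. The bound finally supplied is
    \<open>Q'\<close>.\<close>
  define Q where "Q = 2 * \<bar>\<rho>\<bar> / \<delta>"
  define Q' where "Q' = (2 * Q + \<bar>\<rho>\<bar>) / \<delta>"
  have Q: "\<rho> + \<rho> < \<delta> * norm z" if "Q < norm z" for z :: complex
    using that \<delta> by (simp add: Q_def field_simps)
  have Q': "2 * Q + \<rho> < \<delta> * norm z" if "Q' < norm z" for z :: complex
    using that \<delta> by (simp add: Q'_def field_simps)
  have "u' = u \<or> u' = sgn v \<and> u = - sgn v"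
    if v: "v \<in> V" and t: "0 \<le> t" and u: "u \<in> U" and u': "u' \<in> U"
      and x: "Q' < norm x" "x \<in> tube u \<rho>"
      and y: "Q' < norm (x + of_real t * v)" "x + of_real t * v \<in> tube u' \<rho>"
      and seg: "closed_segment x (x + of_real t * v) \<subseteq> (\<Union>u\<in>U. tube u \<rho>)"
    for x v t u u'
  proof (cases "closed_segment x (x + of_real t * v) \<inter> cball 0 Q = {}")
    case True
    let ?S = "closed_segment x (x + of_real t * v)"
    let ?T = "\<Union>w\<in>U - {u}. tube w \<rho>"
    have "closed ?T" using assms(1) closed_tube by blast
    moreover have "?S \<subseteq> tube u \<rho> \<union> ?T" using seg by blast
    moreover have "tube u \<rho> \<inter> ?T \<inter> ?S = {}"
    proof -
      have False if z: "z \<in> tube u \<rho>" "z \<in> tube w \<rho>" "z \<in> ?S" "w \<in> U" "w \<noteq> u" for z w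
      proof -
        have "Q < norm z" using z(3) True by (auto simp: not_le disjoint_iff)
        then show False using same[OF _ _ z(1,2) Q] z u by (auto simp: W_def)
      qed
      then show ?thesis by blast
    qed
    moreover have "x \<in> tube u \<rho> \<inter> ?S" using x by simp
    \<comment> \<open>The connected segment is covered by two closed sets that are disjoint on it;
      it starts in \<open>tube u \<rho>\<close>, so it misses all other tubes.\<close>
    ultimately have "?T \<inter> ?S = {}"
      using connected_closedD[OF connected_segment(1)[of x "x + of_real t * v"]
          _ _ closed_tube[of u \<rho>] \<open>closed ?T\<close>]
      by blast
    then show ?thesis using y u' by auto
  next
    case False
    then obtain z where z: "z \<in> closed_segment x (x + of_real t * v)" "norm z \<le> Q" by auto
    then obtain a where a: "0 \<le> a" "a \<le> 1" "z = (1 - a) *\<^sub>R x + a *\<^sub>R (x + of_real t * v)"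
      by (auto simp: in_segment)
    have "v \<noteq> 0" using v assms(4) by blast
    then have vs: "v = norm v *\<^sub>R sgn v" "norm (sgn v) = 1" by (simp_all add: sgn_div_norm)
    have scale: "(c * norm v) *\<^sub>R sgn v = of_real c * v" for c
      using vs(1) by (metis scaleR_scaleR scaleR_conv_of_real)
    \<comment> \<open>Flying from \<open>x\<close> for the time \<open>a * t\<close> leads to
      \<open>z\<close>, so \<open>x\<close> differs by \<open>z\<close> from a point of the ray in
      direction \<open>- sgn v\<close>. The other end is treated likewise with the remaining time
      \<open>(1 - a) * t\<close>.\<close>
    have "norm (x - ((a * t) * norm v) *\<^sub>R (- sgn v)) = norm z"
      unfolding scaleR_minus_right scale
      using a(3) by (simp add: scaleR_conv_of_real algebra_simps)
    then have 1: "x \<in> tube (- sgn v) (2 * Q)"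
      using near_ray_in_tube[of "- sgn v" "(a * t) * norm v" x Q] vs z a t by simp
    have "norm ((x + of_real t * v) - ((1 - a) * t * norm v) *\<^sub>R sgn v) = norm z"
      unfolding scale
      using a(3) by (simp add: scaleR_conv_of_real algebra_simps)
    then have 2: "x + of_real t * v \<in> tube (sgn v) (2 * Q)"
      using near_ray_in_tube[of "sgn v" "(1 - a) * t * norm v" "x + of_real t * v" Q] vs z a t
      by simp
    have "- sgn v = u" using same[OF _ _ 1 x(2) Q'[OF x(1)]] u v by (auto simp: W_def)
    moreover have "sgn v = u'" using same[OF _ _ 2 y(2) Q'[OF y(1)]] u' v by (auto simp: W_def)
    ultimately show ?thesis by auto
  qed
  then show ?thesis by (rule that[of Q'])
qed

section \<open>Walls\<close>

lemma wallE:
  assumes "w \<in> walls"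
  obtains a e where "a \<in> corners" "e = 1 \<or> e = \<i>" "w = closed_segment a (a + e)"
  using assms by (auto simp: walls_def hwalls_def vwalls_def)

lemma compact_wall: "w \<in> walls \<Longrightarrow> compact w"
  by (auto elim!: wallE)

lemma wall_nonempty: "w \<in> walls \<Longrightarrow> w \<noteq> {}"
  by (auto elim!: wallE)

lemma hwall_iff:
  "z \<in> closed_segment a (a + 1) \<longleftrightarrow> Im z = Im a \<and> Re a \<le> Re z \<and> Re z \<le> Re a + 1"
proof
  assume "z \<in> closed_segment a (a + 1)"
  then show "Im z = Im a \<and> Re a \<le> Re z \<and> Re z \<le> Re a + 1"
    by (auto simp: in_segment algebra_simps)
next
  assume *: "Im z = Im a \<and> Re a \<le> Re z \<and> Re z \<le> Re a + 1"
  then show "z \<in> closed_segment a (a + 1)"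
    by (auto simp: in_segment complex_eq_iff algebra_simps intro!: exI[of _ "Re z - Re a"])
qed

lemma vwall_iff:
  "z \<in> closed_segment a (a + \<i>) \<longleftrightarrow> Re z = Re a \<and> Im a \<le> Im z \<and> Im z \<le> Im a + 1"
proof
  assume "z \<in> closed_segment a (a + \<i>)"
  then show "Re z = Re a \<and> Im a \<le> Im z \<and> Im z \<le> Im a + 1"
    by (auto simp: in_segment algebra_simps)
next
  assume *: "Re z = Re a \<and> Im a \<le> Im z \<and> Im z \<le> Im a + 1"
  then show "z \<in> closed_segment a (a + \<i>)"
    by (auto simp: in_segment complex_eq_iff algebra_simps intro!: exI[of _ "Im z - Im a"])
qed

lemma wall_dist_le:
  assumes "w \<in> walls" "x \<in> w" "y \<in> w"
  shows "dist x y \<le> 1"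
proof -
  obtain a e where e: "e = 1 \<or> e = \<i>" and w: "w = closed_segment a (a + e)"
    using assms(1) by (rule wallE)
  from e have "\<bar>Re (x - y)\<bar> + \<bar>Im (x - y)\<bar> \<le> 1"
    using assms(2,3) by (elim disjE) (simp_all add: w hwall_iff vwall_iff abs_le_iff)
  then show ?thesis using cmod_le[of "x - y"] by (simp add: dist_norm)
qed

lemma vwall_through:
  assumes "Re z \<in> \<int>"
  obtains w where "w \<in> walls" "z \<in> w"
proof -
  define a where "a = Complex (Re z) (of_int \<lfloor>Im z\<rfloor>)"
  have "a \<in> corners" using assms by (simp add: a_def corners_def)
  then have "closed_segment a (a + \<i>) \<in> walls" unfolding walls_def vwalls_def by blast
  moreover have "Im z \<le> of_int \<lfloor>Im z\<rfloor> + 1" by linarith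
  then have "z \<in> closed_segment a (a + \<i>)" by (simp add: vwall_iff a_def)
  ultimately show ?thesis by (rule that)
qed

text \<open>As \<open>x\<close> is not an integer, \<open>x = a + 1\<close> is excluded and both
  \<open>a\<close> and \<open>b\<close> are the floor of \<open>x\<close>.\<close>

lemma Ints_floor_unique:
  fixes x a b :: real
  assumes "x \<notin> \<int>" "a \<in> \<int>" "b \<in> \<int>" "a \<le> x" "x \<le> a + 1" "b \<le> x" "x \<le> b + 1"
  shows "a = b"
proof -
  have "\<exists>k. c = of_int k \<and> k = \<lfloor>x\<rfloor>" if c: "c \<in> \<int>" "c \<le> x" "x \<le> c + 1" for c
  proof -
    obtain k where k: "c = of_int k" using c by (auto elim: Ints_cases)
    have "c + 1 \<in> \<int>" using c by simp
    then have "x \<noteq> c + 1" using assms(1) by blast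
    then show ?thesis using c k by (intro exI[of _ k]) (auto simp: floor_unique)
  qed
  then show ?thesis using assms by metis
qed

text \<open>A point of a wall that is not a corner has exactly one non-integer coordinate. That
  coordinate fixes the orientation of the wall, and its floor fixes the position.\<close>

lemma wall_unique:
  assumes "w \<in> walls" "w' \<in> walls" "z \<in> w" "z \<in> w'" "z \<notin> corners"
  shows "w = w'"
proof -
  obtain a e where a: "a \<in> corners" "e = 1 \<or> e = \<i>" "w = closed_segment a (a + e)"
    using assms(1) by (rule wallE)
  obtain a' e' where a': "a' \<in> corners" "e' = 1 \<or> e' = \<i>" "w' = closed_segment a' (a' + e')"
    using assms(2) by (rule wallE)
  have "\<not> (Re z \<in> \<int> \<and> Im z \<in> \<int>)" using assms(5) by (simp add: corners_def)
  moreover have ints: "Re a \<in> \<int>" "Im a \<in> \<int>" "Re a' \<in> \<int>" "Im a' \<in> \<int>"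
    using a(1) a'(1) by (auto simp: corners_def)
  ultimately consider "e = 1" "e' = 1" "Re z \<notin> \<int>" | "e = \<i>" "e' = \<i>" "Im z \<notin> \<int>"
    using a(2,3) a'(2,3) assms(3,4) hwall_iff vwall_iff by metis
  then show ?thesis
  proof cases
    case 1
    then have "Re a = Re a'" "Im a = Im a'"
      using a(3) a'(3) assms(3,4) Ints_floor_unique[OF 1(3) ints(1,3)] by (auto simp: hwall_iff)
    then have "a = a'" by (rule complex_eqI)
    then show ?thesis using 1 a(3) a'(3) by simp
  next
    case 2
    then have "Re a = Re a'" "Im a = Im a'"
      using a(3) a'(3) assms(3,4) Ints_floor_unique[OF 2(3) ints(2,4)] by (auto simp: vwall_iff)
    then have "a = a'" by (rule complex_eqI)
    then show ?thesis using 2 a(3) a'(3) by simp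
  qed
qed

lemma finite_walls_meeting_cball: "finite {w \<in> walls. w \<inter> cball 0 r \<noteq> {}}"
proof -
  \<comment> \<open>The base corner of a wall differs from any of its points by at most 1 in each
    coordinate, hence the added 1.\<close>
  define k where "k = \<lceil>r\<rceil> + 1"
  define F where "F = (\<lambda>(i, j). Complex (of_int i) (of_int j)) ` ({-k..k} \<times> {-k..k})"
  have "finite F" by (simp add: F_def)
  have "a \<in> F" if a: "a \<in> corners" and e: "e = 1 \<or> e = \<i>"
    and z: "z \<in> closed_segment a (a + e)" "norm z \<le> r" for a e z
  proof -
    obtain i j where ij: "Re a = of_int i" "Im a = of_int j"
      using a by (auto simp: corners_def elim!: Ints_cases)
    have "\<bar>Re a - Re z\<bar> \<le> 1" "\<bar>Im a - Im z\<bar> \<le> 1"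
      using e z(1) by (auto simp: hwall_iff vwall_iff)
    moreover have "\<bar>Re z\<bar> \<le> r" "\<bar>Im z\<bar> \<le> r"
      using z(2) abs_Re_le_cmod[of z] abs_Im_le_cmod[of z] by linarith+
    ultimately have "\<bar>i\<bar> \<le> k" "\<bar>j\<bar> \<le> k"
      unfolding k_def using ij by linarith+
    then have "(i, j) \<in> {-k..k} \<times> {-k..k}" by auto
    moreover have "a = Complex (of_int i) (of_int j)" using ij by (simp add: complex_eq_iff)
    ultimately show ?thesis unfolding F_def by force
  qed
  then have "{w \<in> walls. w \<inter> cball 0 r \<noteq> {}}
      \<subseteq> (\<lambda>(a, e). closed_segment a (a + e)) ` (F \<times> {1, \<i>})"
    by (fastforce elim!: wallE)
  then show ?thesis using \<open>finite F\<close> finite_subset by blast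
qed

section \<open>Blasts\<close>

lemma affine_image_segment:
  fixes a b c d :: complex
  shows "(\<lambda>z. c * z + d) ` closed_segment a b = closed_segment (c * a + d) (c * b + d)"
proof -
  have "(\<lambda>z. c * z + d) ` closed_segment a b = (+) d ` ((*) c ` closed_segment a b)"
    by (simp add: image_image add.commute)
  also have "\<dots> = closed_segment (d + c * a) (d + c * b)"
    by (simp add: closed_segment_translation closed_segment_linear_image bounded_linear_mult_right
        bounded_linear.linear)
  finally show ?thesis by (simp add: add.commute)
qed

text \<open>Since \<open>m\<close> is a member of \<open>B\<close>, it suffices to find a rigid
  motion of the required kind that takes \<open>m\<close> to \<open>w\<close>. It exists because the
  particle never moves parallel to a wall.\<close>

lemma hit_wall_erased:
  assumes "bomb m B" "w \<in> walls" "Re v \<noteq> 0" "Im v \<noteq> 0"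
  shows "w \<in> blast_area m B w v"
proof -
  obtain a where a: "m = closed_segment a (a + 1)" "m \<in> B"
    using assms(1) by (auto simp: bomb_def hwalls_def)
  obtain f e where w: "e = 1 \<or> e = \<i>" "w = closed_segment f (f + e)"
    using assms(2) by (rule wallE)
  have "\<exists>c d. norm c = 1 \<and> (\<lambda>z. c * z + d) ` m = w \<and> Im (v / c) > 0"
  proof -
    \<comment> \<open>One case for each side from which a wall can be hit, with rotation by 1, -1,
      \<open>\<i>\<close> and \<open>-\<i>\<close> respectively. In the second and fourth case the
      endpoints of the wall are interchanged.\<close>
    consider "e = 1" "Im v > 0" | "e = 1" "Im v < 0" | "e = \<i>" "Re v < 0" | "e = \<i>" "Re v > 0"
      using w(1) assms(3,4) by linarith
    then show ?thesis
    proof cases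
      case 1
      then show ?thesis
        by (intro exI[of _ 1] exI[of _ "f - a"])
          (simp only: a w affine_image_segment, simp add: algebra_simps)
    next
      case 2
      then show ?thesis
        by (intro exI[of _ "-1"] exI[of _ "f + 1 + a"])
          (simp only: a w affine_image_segment, simp add: algebra_simps closed_segment_commute)
    next
      case 3
      then show ?thesis
        by (intro exI[of _ \<i>] exI[of _ "f - \<i> * a"])
          (simp only: a w affine_image_segment, simp add: algebra_simps Im_divide)
    next
      case 4
      then show ?thesis
        by (intro exI[of _ "-\<i>"] exI[of _ "f + \<i> + \<i> * a"])
          (simp only: a w affine_image_segment,
            simp add: algebra_simps Im_divide closed_segment_commute)
    qed
  qed
  then show ?thesis using a unfolding blast_area_def by blast
qed

text \<open>Rigid motions preserve distances, and \<open>w\<close> is the image of \<open>m\<close>,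
  which belongs to \<open>B\<close>. So a bound on the distances within the union of
  \<open>B\<close> serves for all \<open>w\<close> and \<open>v\<close> at once.\<close>

lemma blast_area_bounded:
  assumes "bomb m B"
  obtains D where "0 \<le> D"
    "\<forall>w v. \<forall>b\<in>blast_area m B w v. \<forall>x\<in>b. \<forall>y\<in>w. dist x y \<le> D"
proof -
  have "bounded (\<Union>B)"
    using assms compact_wall compact_imp_bounded by (auto simp: bomb_def)
  then obtain D where D: "\<forall>x\<in>\<Union>B. \<forall>y\<in>\<Union>B. dist x y \<le> D"
    unfolding bounded_two_points by (rule exE)
  show ?thesis
  proof (rule that[OF abs_ge_zero], intro allI ballI)
    fix w v b x y
    assume b: "b \<in> blast_area m B w v" "x \<in> b" "y \<in> w"
    then obtain c d x' y' where c: "norm c = 1" "x = c * x' + d" "y = c * y' + d"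
      and x': "x' \<in> \<Union>B" and y': "y' \<in> \<Union>B"
      using assms unfolding blast_area_def bomb_def by blast
    have "dist x y = norm (c * (x' - y'))" by (simp add: c dist_norm algebra_simps)
    also have "\<dots> = dist x' y'" using c by (simp add: norm_mult dist_norm)
    finally show "dist x y \<le> \<bar>D\<bar>" using bspec[OF bspec[OF D x'] y'] by linarith
  qed
qed

section \<open>The trajectory\<close>

lemma collidesE:
  assumes "collides m B \<sigma> w \<sigma>'"
  obtains t where "0 < t" "free_flight \<sigma> t" "pos \<sigma>' = pos \<sigma> + of_real t * vel \<sigma>"
    "pos \<sigma>' \<notin> corners" "w \<in> solid \<sigma>" "pos \<sigma>' \<in> w" "vel \<sigma>' = reflect w (vel \<sigma>)"
    "solid \<sigma>' = solid \<sigma> - blast_area m B w (vel \<sigma>)"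
  using assms by (auto elim!: collides.cases)

text \<open>Of two different collision times the earlier would interrupt the free flight up to the
  later; and a point that is not a corner lies on only one wall.\<close>

lemma collides_deterministic:
  assumes "solid \<sigma> \<subseteq> walls" "collides m B \<sigma> w1 \<sigma>1" "collides m B \<sigma> w2 \<sigma>2"
  shows "w1 = w2 \<and> \<sigma>1 = \<sigma>2"
proof -
  obtain t1 where 1: "0 < t1" "free_flight \<sigma> t1" "pos \<sigma>1 = pos \<sigma> + of_real t1 * vel \<sigma>"
    "pos \<sigma>1 \<notin> corners" "w1 \<in> solid \<sigma>" "pos \<sigma>1 \<in> w1" "vel \<sigma>1 = reflect w1 (vel \<sigma>)"
    "solid \<sigma>1 = solid \<sigma> - blast_area m B w1 (vel \<sigma>)"
    using assms(2) by (rule collidesE)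
  obtain t2 where 2: "0 < t2" "free_flight \<sigma> t2" "pos \<sigma>2 = pos \<sigma> + of_real t2 * vel \<sigma>"
    "pos \<sigma>2 \<notin> corners" "w2 \<in> solid \<sigma>" "pos \<sigma>2 \<in> w2" "vel \<sigma>2 = reflect w2 (vel \<sigma>)"
    "solid \<sigma>2 = solid \<sigma> - blast_area m B w2 (vel \<sigma>)"
    using assms(3) by (rule collidesE)
  have "t1 = t2"
    using 1 2 unfolding free_flight_def by (metis UnI1 UnionI linorder_neqE_linordered_idom)
  then have pos: "pos \<sigma>1 = pos \<sigma>2" using 1(3) 2(3) by simp
  moreover have "w1 = w2"
  proof (rule wall_unique)
    show "pos \<sigma>1 \<in> w2" using 2(6) pos by simp
  qed (use 1 2 assms(1) in blast)+
  ultimately show ?thesis using 1 2 by (simp add: state.expand)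
qed

lemma reachable_solid_subset: "reachable m B s p \<sigma> \<Longrightarrow> solid \<sigma> \<subseteq> walls"
  by (induction rule: reachable.induct) (auto elim!: collidesE)

text \<open>A reflection changes the sign of one component. Two consequences matter: there are
  finitely many velocities, and the horizontal speed is always 1.\<close>

lemma reachable_vel:
  assumes "reachable m B s p \<sigma>"
  shows "vel \<sigma> \<in> {Complex 1 s, Complex 1 (-s), Complex (-1) s, Complex (-1) (-s)}"
  using assms
proof (induction rule: reachable.induct)
  case (bounce \<sigma> w \<sigma>')
  from bounce.hyps(2) have "vel \<sigma>' = reflect w (vel \<sigma>)" by (rule collidesE)
  then show ?case using bounce.IH by (auto simp: reflect_def complex_eq_iff)
qed simp

lemma hit_walls_subset: "hit_walls m B s p \<subseteq> walls"
  using reachable_solid_subset by (fastforce simp: hit_walls_def elim!: collidesE)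

text \<open>All walls are solid at the start, and a wall stops being solid only through the blast of
  some collision.\<close>

lemma erased_near_hit_wall:
  assumes "reachable m B s p \<sigma>"
    and D: "\<forall>w v. \<forall>b\<in>blast_area m B w v. \<forall>x\<in>b. \<forall>y\<in>w. dist x y \<le> D"
    and "b \<in> walls" "b \<notin> solid \<sigma>"
  shows "\<exists>w\<in>hit_walls m B s p. \<forall>x\<in>b. \<forall>y\<in>w. dist x y \<le> D"
  using assms(1,3,4)
proof (induction rule: reachable.induct)
  case (bounce \<sigma> w \<sigma>')
  show ?case
  proof (cases "b \<in> solid \<sigma>")
    case True
    moreover have "solid \<sigma>' = solid \<sigma> - blast_area m B w (vel \<sigma>)"
      using bounce.hyps(2) by (rule collidesE)
    ultimately have "b \<in> blast_area m B w (vel \<sigma>)" using bounce.prems by blast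
    then have "\<forall>x\<in>b. \<forall>y\<in>w. dist x y \<le> D" using D by blast
    moreover have "w \<in> hit_walls m B s p" using bounce.hyps by (auto simp: hit_walls_def)
    ultimately show ?thesis by blast
  qed (use bounce in blast)
qed simp

section \<open>Flights between collisions stay close to the rays\<close>

text \<open>With \<open>e\<close> as horizontal velocity, the target is the first integer strictly
  ahead of \<open>a\<close>. Strictness matters because nothing counts as hit at time 0.\<close>

lemma next_integer_time:
  fixes a e :: real
  assumes "e = 1 \<or> e = -1"
  obtains h where "0 < h" "h \<le> 1" "a + h * e \<in> \<int>"
proof (cases "e = 1")
  case True
  have "a + (of_int \<lfloor>a\<rfloor> + 1 - a) * e \<in> \<int>" using True by simp
  moreover have "0 < of_int \<lfloor>a\<rfloor> + 1 - a" "of_int \<lfloor>a\<rfloor> + 1 - a \<le> 1" by linarith+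
  ultimately show ?thesis using that by blast
next
  case False
  then have "a + (a - of_int \<lceil>a\<rceil> + 1) * e \<in> \<int>" using assms by simp
  moreover have "0 < a - of_int \<lceil>a\<rceil> + 1" "a - of_int \<lceil>a\<rceil> + 1 \<le> 1" by linarith+
  ultimately show ?thesis using that by blast
qed

text \<open>Within unit time the particle reaches a vertical grid line or its next collision, and
  wherever it crosses a grid line there is an erased wall.\<close>

lemma flight_in_tubes:
  assumes r: "reachable m B s p \<sigma>" and c: "collides m B \<sigma> w \<sigma>'"
    and D: "0 \<le> D"
      "\<forall>w v. \<forall>b\<in>blast_area m B w v. \<forall>x\<in>b. \<forall>y\<in>w. dist x y \<le> D"
    and U: "\<And>u. u \<in> U \<Longrightarrow> norm u = 1"
    and hit: "\<And>w. w \<in> hit_walls m B s p \<Longrightarrow> w \<subseteq> (\<Union>u\<in>U. tube u \<rho>)"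
  shows "closed_segment (pos \<sigma>) (pos \<sigma>') \<subseteq> (\<Union>u\<in>U. tube u (\<rho> + 2 * D + 2 * norm (Complex 1 s)))"
proof
  fix z assume "z \<in> closed_segment (pos \<sigma>) (pos \<sigma>')"
  then obtain a where a: "0 \<le> a" "a \<le> 1" "z = (1 - a) *\<^sub>R pos \<sigma> + a *\<^sub>R pos \<sigma>'"
    by (auto simp: in_segment)
  let ?v = "vel \<sigma>"
  obtain t where t: "0 < t" "free_flight \<sigma> t" "pos \<sigma>' = pos \<sigma> + of_real t * ?v" "pos \<sigma>' \<in> w"
    using c by (rule collidesE)
  define h where "h = a * t"
  have h: "0 \<le> h" "h \<le> t" using a t by (auto simp: h_def mult_left_le_one_le)
  have z: "z = pos \<sigma> + of_real h * ?v"
    using a t by (simp add: h_def scaleR_conv_of_real algebra_simps)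
  have v: "Re ?v = 1 \<or> Re ?v = -1" and nv: "norm ?v = norm (Complex 1 s)"
    using reachable_vel[OF r] by (auto simp: cmod_def)
  have w: "w \<in> hit_walls m B s p" using r c by (auto simp: hit_walls_def)
  have "\<exists>h'. h \<le> h' \<and> h' \<le> h + 1 \<and> pos \<sigma> + of_real h' * ?v \<in> (\<Union>u\<in>U. tube u (\<rho> + 2 * D))"
  proof (cases "h + 1 < t")
    case True
    obtain k where k: "0 < k" "k \<le> 1" "Re z + k * Re ?v \<in> \<int>"
      using next_integer_time[OF v] by blast
    define q where "q = pos \<sigma> + of_real (h + k) * ?v"
    have "Re q \<in> \<int>" using k(3) by (simp add: q_def z algebra_simps)
    then obtain b where b: "b \<in> walls" "q \<in> b" using vwall_through by blast
    \<comment> \<open>The crossing takes place strictly between the times 0 and \<open>t\<close>,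
      where free flight excludes solid walls.\<close>
    have "b \<notin> solid \<sigma>"
    proof
      assume "b \<in> solid \<sigma>"
      moreover have "0 < h + k" "h + k < t" using h k True by linarith+
      then have "q \<notin> \<Union> (solid \<sigma>)" using t(2) unfolding free_flight_def q_def by blast
      ultimately show False using b by blast
    qed
    then obtain w' where w': "w' \<in> hit_walls m B s p" "\<forall>x\<in>b. \<forall>y\<in>w'. dist x y \<le> D"
      using erased_near_hit_wall[OF r D(2) b(1)] by blast
    obtain y where y: "y \<in> w'" using w'(1) hit_walls_subset wall_nonempty by blast
    then obtain u where "u \<in> U" "y \<in> tube u \<rho>" using hit[OF w'(1)] by blast
    then have "q \<in> tube u (\<rho> + 2 * D)" using tube_thicken U w' y b by blast
    then show ?thesis using \<open>u \<in> U\<close> k by (intro exI[of _ "h + k"]) (auto simp: q_def)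
  next
    case False
    obtain u where u: "u \<in> U" "pos \<sigma>' \<in> tube u \<rho>" using hit[OF w] t by blast
    then have "pos \<sigma>' \<in> tube u (\<rho> + 2 * D)" using tube_mono D by simp
    then show ?thesis using u False h t(3) by (intro exI[of _ t]) auto
  qed
  then obtain h' u where h': "h \<le> h'" "h' \<le> h + 1" and u: "u \<in> U"
    and q: "pos \<sigma> + of_real h' * ?v \<in> tube u (\<rho> + 2 * D)" by blast
  \<comment> \<open>At most unit time passes between the two points, so their distance is at most
    the speed.\<close>
  have "dist z (pos \<sigma> + of_real h' * ?v) = norm (of_real (h - h') * ?v)"
    by (simp add: z dist_norm algebra_simps)
  also have "\<dots> = \<bar>h - h'\<bar> * norm ?v" by (simp only: norm_mult norm_of_real)
  also have "\<dots> \<le> 1 * norm ?v" using h' by (intro mult_right_mono) auto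
  finally have "z \<in> tube u (\<rho> + 2 * D + 2 * norm ?v)"
    using tube_thicken[OF q U[OF u]] by simp
  then show "z \<in> (\<Union>u\<in>U. tube u (\<rho> + 2 * D + 2 * norm (Complex 1 s)))" using u nv by auto
qed

section \<open>The sequence of all collisions\<close>

text \<open>Determinism arranges the reachable states in a single sequence of iterates; if it ended,
  only finitely many walls would be hit.\<close>

lemma hit_sequence:
  assumes "infinite (hit_walls m B s p)"
  obtains S w where "\<And>n. reachable m B s p (S n)" "\<And>n. collides m B (S n) (w n) (S (Suc n))"
    "hit_walls m B s p = range w"
proof -
  \<comment> \<open>Next state and next wall; both are arbitrary when no collision follows.\<close>
  define f where "f \<sigma> = (SOME \<sigma>'. \<exists>w. collides m B \<sigma> w \<sigma>')" for \<sigma>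
  define g where "g \<sigma> = (SOME w. collides m B \<sigma> w (f \<sigma>))" for \<sigma>
  define S where "S n = (f ^^ n) (State p (Complex 1 s) walls)" for n
  have gf: "w = g \<sigma> \<and> \<sigma>' = f \<sigma>" if "reachable m B s p \<sigma>" "collides m B \<sigma> w \<sigma>'" for \<sigma> w \<sigma>'
  proof -
    have "\<exists>w. collides m B \<sigma> w (f \<sigma>)" unfolding f_def by (rule someI2_ex) (use that in blast)+
    then have "collides m B \<sigma> (g \<sigma>) (f \<sigma>)" unfolding g_def by (rule someI_ex)
    then show ?thesis
      using collides_deterministic[OF reachable_solid_subset[OF that(1)] that(2)] by blast
  qed
  \<comment> \<open>The second conjunct records that the states before index \<open>n\<close> really
    collide, so no reachable state lies beyond an index where the motion is stuck.\<close>
  have reach: "\<exists>n. \<sigma> = S n \<and> (\<forall>k<n. \<exists>w \<sigma>'. collides m B (S k) w \<sigma>')" if "reachable m B s p \<sigma>" for \<sigma>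
    using that
  proof (induction rule: reachable.induct)
    case start
    show ?case by (intro exI[of _ 0]) (simp add: S_def)
  next
    case (bounce \<sigma> w \<sigma>')
    then obtain n where n: "\<sigma> = S n" "\<forall>k<n. \<exists>w \<sigma>'. collides m B (S k) w \<sigma>'" by blast
    have "\<sigma>' = S (Suc n)" using gf bounce.hyps n by (simp add: S_def)
    then show ?case using n bounce.hyps by (intro exI[of _ "Suc n"]) (auto simp: less_Suc_eq)
  qed
  have moves: "\<exists>w \<sigma>'. collides m B (S n) w \<sigma>'" for n
  proof (rule ccontr)
    assume stuck: "\<nexists>w \<sigma>'. collides m B (S n) w \<sigma>'"
    have "hit_walls m B s p \<subseteq> (\<lambda>k. g (S k)) ` {..n}"
    proof
      fix w assume "w \<in> hit_walls m B s p"
      then obtain \<sigma> \<sigma>' where \<sigma>: "reachable m B s p \<sigma>" "collides m B \<sigma> w \<sigma>'"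
        by (auto simp: hit_walls_def)
      then obtain k where k: "\<sigma> = S k" "\<forall>j<k. \<exists>w \<sigma>'. collides m B (S j) w \<sigma>'"
        using reach by blast
      then have "k \<le> n" using stuck by (meson not_le)
      then show "w \<in> (\<lambda>k. g (S k)) ` {..n}" using gf \<sigma> k by auto
    qed
    then show False using assms finite_subset by blast
  qed
  have step: "reachable m B s p (S n) \<and> collides m B (S n) (g (S n)) (S (Suc n))" for n
  proof (induction n)
    case 0
    have "reachable m B s p (S 0)" by (simp add: S_def start)
    then show ?case using moves[of 0] gf by (fastforce simp: S_def)
  next
    case (Suc n)
    then have r: "reachable m B s p (S (Suc n))" by (blast intro: bounce)
    obtain w \<sigma>' where "collides m B (S (Suc n)) w \<sigma>'" using moves by blast
    moreover from this have "w = g (S (Suc n))" "\<sigma>' = S (Suc (Suc n))"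
      using gf[OF r] by (simp_all add: S_def)
    ultimately show ?case using r by blast
  qed
  have "hit_walls m B s p = range (\<lambda>n. g (S n))"
  proof
    show "hit_walls m B s p \<subseteq> range (\<lambda>n. g (S n))"
      using reach gf by (fastforce simp: hit_walls_def)
    show "range (\<lambda>n. g (S n)) \<subseteq> hit_walls m B s p"
      using step by (auto simp: hit_walls_def)
  qed
  then show ?thesis using that[of S "\<lambda>n. g (S n)"] step by blast
qed

text \<open>A wall is erased when it is hit, and solid walls only ever decrease, so it cannot be hit
  again.\<close>

lemma hit_sequence_inj:
  assumes "s > 0" "bomb m B" "\<And>n. reachable m B s p (S n)"
    "\<And>n. collides m B (S n) (w n) (S (Suc n))"
  shows "inj w"
proof -
  have solid: "w n \<in> solid (S n)" "solid (S (Suc n)) = solid (S n) - blast_area m B (w n) (vel (S n))"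
    for n using assms(4)[of n] by (auto elim: collidesE)
  have "w n \<in> walls" for n using solid(1) reachable_solid_subset assms(3) by blast
  moreover have "Re (vel (S n)) \<noteq> 0" "Im (vel (S n)) \<noteq> 0" for n
    using reachable_vel[OF assms(3)[of n]] assms(1) by auto
  ultimately have "w n \<notin> solid (S (Suc n))" for n
    using hit_wall_erased[OF assms(2)] solid(2) by blast
  moreover have "decseq (\<lambda>n. solid (S n))" using solid(2) by (auto intro!: decseq_SucI)
  ultimately have "w k \<notin> solid (S n)" if "k < n" for k n
    using that by (metis Suc_leI decseqD subsetD)
  then show ?thesis using solid(1) by (metis injI linorder_neqE_nat)
qed

section \<open>One band or two opposite bands\<close>

lemma finite_walls_in_cball:
  assumes "finite F" "F \<subseteq> walls"
  obtains r where "\<And>w. w \<in> F \<Longrightarrow> w \<subseteq> cball 0 r"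
proof -
  have "bounded (\<Union>F)"
    using assms compact_wall compact_imp_bounded by auto
  then obtain r where "\<forall>x\<in>\<Union>F. norm x \<le> r" unfolding bounded_iff by (rule exE)
  then show ?thesis by (intro that[of r]) auto
qed

text \<open>Bands become tubes of one common radius, chosen so large that each tube also contains
  the hit walls that meet the disc.\<close>

lemma confined_in_tubes:
  assumes "finite bs" "bs \<subseteq> bands" "bs \<noteq> {}" "confined_outside m B s p (cball c r) bs"
  obtains \<rho> where "0 \<le> \<rho>"
    "\<And>w. w \<in> hit_walls m B s p \<Longrightarrow> w \<subseteq> (\<Union>u\<in>direction ` bs. tube u \<rho>)"
proof -
  define F where "F b = 2 * (radius b + norm (base b))" for b
  \<comment> \<open>The first summand takes care of walls meeting the disc, which reach at most 1
    beyond it; the sum dominates the tube radius of every single band.\<close>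
  define \<rho> where "\<rho> = 2 * (norm c + \<bar>r\<bar> + 1) + (\<Sum>b\<in>bs. F b)"
  have F: "0 \<le> F b" if "b \<in> bs" for b using that assms(2) by (auto simp: F_def bands_def)
  then have sum: "0 \<le> (\<Sum>b\<in>bs. F b)" by (rule sum_nonneg)
  have "w \<subseteq> (\<Union>u\<in>direction ` bs. tube u \<rho>)" if w: "w \<in> hit_walls m B s p" for w
  proof (cases "w \<inter> cball c r = {}")
    case True
    have "region b \<subseteq> tube (direction b) \<rho>" if "b \<in> bs" for b
    proof -
      have "F b \<le> (\<Sum>b\<in>bs. F b)" using member_le_sum[OF that] F assms(1) by auto
      then have "F b \<le> \<rho>" by (simp add: \<rho>_def add_increasing)
      then show ?thesis
        using region_subset_tube[of b] tube_mono that assms(2) by (fastforce simp: F_def)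
    qed
    moreover have "w \<subseteq> (\<Union>b\<in>bs. region b)" using assms(4) w True by (simp add: confined_outside_def)
    ultimately show ?thesis by blast
  next
    case False
    then obtain y where y: "y \<in> w" "dist c y \<le> r" by auto
    obtain b where b: "b \<in> bs" using assms(3) by blast
    have "x \<in> tube (direction b) \<rho>" if "x \<in> w" for x
    proof -
      have "dist x y \<le> 1" using wall_dist_le w hit_walls_subset that y by blast
      then have "norm x \<le> norm c + \<bar>r\<bar> + 1"
        using y(2) dist_triangle[of x 0 y] dist_triangle[of y 0 c] by (simp add: dist_commute)
      then have "x \<in> tube (direction b) (2 * (norm c + \<bar>r\<bar> + 1))"
        using b assms(2) by (intro cball_in_tube) (auto simp: bands_def)
      then show ?thesis using tube_mono sum by (simp add: \<rho>_def)
    qed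
    then show ?thesis using b by blast
  qed
  moreover have "0 \<le> \<rho>" using sum by (simp add: \<rho>_def)
  ultimately show ?thesis using that by blast
qed

text \<open>Each collision point is labelled by a direction whose tube contains it. If the label
  eventually stayed constant, one band would suffice; a late change turns it into its negative and
  forces slope \<open>s\<close>. Since \<open>u\<close> and \<open>- u\<close> both come from
  \<open>bs\<close>, the lemma also determines the directions of any given pair of bands.\<close>

lemma one_band_or_opposite_bands:
  assumes "s > 0" "bomb m B"
    and bs: "finite bs" "bs \<subseteq> bands" "confined_outside m B s p (cball c r) bs"
    and not_single: "\<And>c r b. b \<in> bands \<Longrightarrow> \<not> confined_outside m B s p (cball c r) {b}"
  obtains u \<rho> r' where "u \<in> direction ` bs" "- u \<in> direction ` bs" "norm u = 1"
    "\<bar>Im u / Re u\<bar> = s" "0 \<le> \<rho>"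
    "confined_outside m B s p (cball 0 r') {Band 0 u \<rho>, Band 0 (- u) \<rho>}"
proof -
  \<comment> \<open>Finitely many hit walls would fit into a disc, and then any band would
    do.\<close>
  have "infinite (hit_walls m B s p)"
  proof
    assume "finite (hit_walls m B s p)"
    then obtain r where "\<And>w. w \<in> hit_walls m B s p \<Longrightarrow> w \<subseteq> cball 0 r"
      using finite_walls_in_cball hit_walls_subset by metis
    then have "confined_outside m B s p (cball 0 r) {Band 0 1 0}"
      unfolding confined_outside_def using hit_walls_subset wall_nonempty by blast
    then show False using not_single[of "Band 0 1 0"] by (simp add: bands_def)
  qed
  then obtain S w where S: "\<And>n. reachable m B s p (S n)"
    and col: "\<And>n. collides m B (S n) (w n) (S (Suc n))"
    and hits: "hit_walls m B s p = range w"
    by (rule hit_sequence) blast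
  have "bs \<noteq> {}"
    using bs(3) not_single[of "Band 0 1 0" c r] by (auto simp: bands_def confined_outside_def)
  then obtain \<rho>0 where \<rho>0: "0 \<le> \<rho>0"
    "\<And>w. w \<in> hit_walls m B s p \<Longrightarrow> w \<subseteq> (\<Union>u\<in>direction ` bs. tube u \<rho>0)"
    using confined_in_tubes bs by metis
  obtain D where D: "0 \<le> D"
    "\<forall>w v. \<forall>b\<in>blast_area m B w v. \<forall>x\<in>b. \<forall>y\<in>w. dist x y \<le> D"
    using assms(2) by (rule blast_area_bounded) blast
  define U where "U = direction ` bs"
  define V where "V = {Complex 1 s, Complex 1 (-s), Complex (-1) s, Complex (-1) (-s)}"
  define \<rho> where "\<rho> = \<rho>0 + 2 * D + 2 * norm (Complex 1 s)"
  have U: "finite U" "\<And>u. u \<in> U \<Longrightarrow> norm u = 1"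
    using bs by (auto simp: U_def bands_def)
  have "0 \<le> \<rho>" using \<rho>0 D by (simp add: \<rho>_def)
  have hit: "w \<subseteq> (\<Union>u\<in>U. tube u \<rho>0)" if "w \<in> hit_walls m B s p" for w
    using \<rho>0(2)[OF that] by (simp only: U_def)
  have flight: "closed_segment (pos (S n)) (pos (S (Suc n))) \<subseteq> (\<Union>u\<in>U. tube u \<rho>)" for n
    unfolding \<rho>_def
    by (rule flight_in_tubes[OF S col D]) (rule U(2) hit, assumption)+
  have V: "finite V" "0 \<notin> V" by (auto simp: V_def complex_eq_iff)
  obtain Q where Q: "\<And>x v t u u'. \<lbrakk>v \<in> V; 0 \<le> t; u \<in> U; u' \<in> U; Q < norm x;
      Q < norm (x + of_real t * v); x \<in> tube u \<rho>; x + of_real t * v \<in> tube u' \<rho>;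
      closed_segment x (x + of_real t * v) \<subseteq> (\<Union>u\<in>U. tube u \<rho>)\<rbrakk>
    \<Longrightarrow> u' = u \<or> u' = sgn v \<and> u = - sgn v"
    using far_segment_in_tubes[OF U(1) V(1) U(2) V(2), of \<rho>] by metis
  have w: "w n \<in> walls" "pos (S (Suc n)) \<in> w n" for n
    using hits hit_walls_subset[of m B s p] col[of n] by (auto elim: collidesE)
  \<comment> \<open>Finitely many walls meet the disc and each is hit at most once, so there is a
    last index \<open>N\<close> of such hits.\<close>
  have "inj w" by (rule hit_sequence_inj[OF assms(1,2)]) (rule S col)+
  moreover have "finite {v \<in> walls. v \<inter> cball 0 Q \<noteq> {}}" by (rule finite_walls_meeting_cball)
  ultimately have "finite (w -` {v \<in> walls. v \<inter> cball 0 Q \<noteq> {}})" by (rule finite_vimageI[rotated])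
  then obtain N where N: "\<And>n. w n \<in> {v \<in> walls. v \<inter> cball 0 Q \<noteq> {}} \<Longrightarrow> n \<le> N"
    by (auto simp: finite_nat_set_iff_bounded_le)
  \<comment> \<open>The point with index \<open>Suc k\<close> lies on \<open>w k\<close>, whence the
    bound \<open>N + 2\<close>.\<close>
  have far: "Q < norm (pos (S n))" if n: "N + 2 \<le> n" for n
  proof -
    obtain k where k: "n = Suc k" "N < k" using n by (cases n) auto
    then have "w k \<inter> cball 0 Q = {}" using N[of k] w(1) by auto
    then show ?thesis using w(2)[of k] k by (auto simp: disjoint_iff not_le)
  qed
  have "\<exists>u. u \<in> U \<and> pos (S n) \<in> tube u \<rho>" for n using flight[of n] by auto
  then obtain e where e: "\<And>n. e n \<in> U" "\<And>n. pos (S n) \<in> tube (e n) \<rho>" by metis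
  \<comment> \<open>Both ends of such a flight are far out, so by the choice of \<open>Q\<close> the
    labels are opposite and equal to the direction of flight up to sign.\<close>
  have change: "e (Suc n) = - e n \<and> \<bar>Im (e n) / Re (e n)\<bar> = s"
    if n: "N + 2 \<le> n" "e (Suc n) \<noteq> e n" for n
  proof -
    obtain t where t: "0 < t" "pos (S (Suc n)) = pos (S n) + of_real t * vel (S n)"
      using col[of n] by (auto elim: collidesE)
    have v: "vel (S n) \<in> V" using reachable_vel[OF S] by (simp add: V_def)
    have "e (Suc n) = sgn (vel (S n)) \<and> e n = - sgn (vel (S n))"
      using Q[OF v, of t "e n" "e (Suc n)" "pos (S n)"] e[of n] e[of "Suc n"] far[of n]
        far[of "Suc n"] flight[of n] n t by auto
    moreover have "vel (S n) \<noteq> 0" using v V(2) by metis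
    ultimately show ?thesis using v assms(1) by (auto simp: V_def sgn_div_norm)
  qed
  define u where "u = e (N + 2)"
  \<comment> \<open>A wall has diameter at most 1, which adds 2 to the radius.\<close>
  have in_tube: "w n \<subseteq> tube (e (Suc n)) (\<rho> + 2)" for n
  proof
    fix x assume "x \<in> w n"
    then have "dist x (pos (S (Suc n))) \<le> 1" using wall_dist_le w by blast
    then show "x \<in> tube (e (Suc n)) (\<rho> + 2)" using tube_thicken[OF e(2) U(2)[OF e(1)]] by force
  qed
  \<comment> \<open>The disc of radius \<open>r'\<close> swallows the early walls, so every wall
    disjoint from it carries a label in the range where \<open>change\<close> applies.\<close>
  have "finite (w ` {..N + 1})" "w ` {..N + 1} \<subseteq> walls" using w by auto
  then obtain r' where r': "\<And>v. v \<in> w ` {..N + 1} \<Longrightarrow> v \<subseteq> cball 0 r'"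
    by (rule finite_walls_in_cball) blast
  have late: "N + 1 < n" if "w n \<inter> cball 0 r' = {}" for n
  proof (rule ccontr)
    assume "\<not> N + 1 < n"
    then have "w n \<subseteq> cball 0 r'" by (intro r') simp
    then show False using that w(2)[of n] by blast
  qed
  have "\<exists>n\<ge>N + 2. e (Suc n) \<noteq> e n"
  proof (rule ccontr)
    assume no_change: "\<not> (\<exists>n\<ge>N + 2. e (Suc n) \<noteq> e n)"
    have const: "e n = u" if "N + 2 \<le> n" for n
      using that by (induction n rule: dec_induct) (use no_change in \<open>auto simp: u_def\<close>)
    have "w n \<subseteq> region (Band 0 u (\<rho> + 2))" if "w n \<inter> cball 0 r' = {}" for n
      using in_tube[of n] const[of "Suc n"] late[OF that] tube_subset_region[of u "\<rho> + 2"] by simp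
    then have "confined_outside m B s p (cball 0 r') {Band 0 u (\<rho> + 2)}"
      by (auto simp: confined_outside_def hits)
    moreover have "Band 0 u (\<rho> + 2) \<in> bands"
      using U(2) e(1) \<open>0 \<le> \<rho>\<close> by (simp add: bands_def u_def)
    ultimately show False using not_single by blast
  qed
  then obtain n where n: "N + 2 \<le> n" "e (Suc n) \<noteq> e n" by blast
  have two: "e n = u \<or> e n = - u" if "N + 2 \<le> n" for n
    using that
  proof (induction n rule: dec_induct)
    case (step n)
    then show ?case using change[of n] by auto
  qed (simp add: u_def)
  have "w k \<subseteq> region (Band 0 u (\<rho> + 2)) \<union> region (Band 0 (- u) (\<rho> + 2))"
    if "w k \<inter> cball 0 r' = {}" for k
  proof -
    have "e (Suc k) = u \<or> e (Suc k) = - u" using two[of "Suc k"] late[OF that] by simp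
    then have "w k \<subseteq> tube u (\<rho> + 2) \<or> w k \<subseteq> tube (- u) (\<rho> + 2)"
      using in_tube[of k] by metis
    then show ?thesis using tube_subset_region by blast
  qed
  then have "confined_outside m B s p (cball 0 r') {Band 0 u (\<rho> + 2), Band 0 (- u) (\<rho> + 2)}"
    by (auto simp: confined_outside_def hits)
  moreover have "u \<in> U" "norm u = 1" using e(1) U(2) by (auto simp: u_def)
  moreover have "- u \<in> U" "\<bar>Im u / Re u\<bar> = s"
    using two[OF n(1)] change[OF n] e(1)[of n] e(1)[of "Suc n"] by auto
  ultimately show ?thesis using that[of u "\<rho> + 2" r'] \<open>0 \<le> \<rho>\<close> by (simp add: U_def)
qed

text \<open>A wide band can also be described by a shifted parallel ray. Therefore opposite
  directions and slope \<open>s\<close> are claimed for every pair that suffices, but collinearity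
  of the rays only for a suitable pair.\<close>

theorem lemma2p1:
  fixes s :: real and p :: complex and m :: "complex set" and B :: "complex set set"
  assumes "s > 0"
    and "bomb m B"
    and "tunnels m B s p"
  shows "(\<exists>c r bs. finite bs \<and> card bs \<le> 2 \<and> bs \<subseteq> bands \<and>
            confined_outside m B s p (cball c r) bs) \<and>
         ((\<forall>c r. \<forall>b\<in>bands. \<not> confined_outside m B s p (cball c r) {b}) \<longrightarrow>
            (\<forall>c r. \<forall>b1\<in>bands. \<forall>b2\<in>bands. confined_outside m B s p (cball c r) {b1, b2} \<longrightarrow>
               direction b2 = - direction b1 \<and> slope b1 = s \<and> slope b2 = s) \<and>
            (\<exists>c r. \<exists>b1\<in>bands. \<exists>b2\<in>bands. confined_outside m B s p (cball c r) {b1, b2} \<and>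
               direction b2 = - direction b1 \<and> collinear (ray b1 \<union> ray b2)))"
proof (cases "\<exists>c r. \<exists>b\<in>bands. confined_outside m B s p (cball c r) {b}")
  case True
  then obtain c r b where "b \<in> bands" "confined_outside m B s p (cball c r) {b}" by blast
  then have "\<exists>c r bs. finite bs \<and> card bs \<le> 2 \<and> bs \<subseteq> bands \<and>
      confined_outside m B s p (cball c r) bs"
    by (intro exI[of _ c] exI[of _ r] exI[of _ "{b}"]) simp
  then show ?thesis using True by blast
next
  case False
  then have not_single: "\<And>c r b. b \<in> bands \<Longrightarrow> \<not> confined_outside m B s p (cball c r) {b}"
    by blast
  obtain c r bs where "finite bs" "bs \<subseteq> bands" "confined_outside m B s p (cball c r) bs"
    using assms(3) by (auto simp: tunnels_def)
  then obtain u \<rho> r' where u: "norm u = 1" "0 \<le> \<rho>"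
    "confined_outside m B s p (cball 0 r') {Band 0 u \<rho>, Band 0 (- u) \<rho>}"
    using one_band_or_opposite_bands[OF assms(1,2) _ _ _ not_single] by metis
  define b1 b2 where "b1 = Band 0 u \<rho>" "b2 = Band 0 (- u) \<rho>"
  note b = this
  have bands: "b1 \<in> bands" "b2 \<in> bands" using u by (auto simp: b bands_def)
  have "ray b1 \<union> ray b2 \<subseteq> span {u}"
  proof -
    have "of_real t * u \<in> span {u}" for t
      using span_scale[OF span_base[of u "{u}"], of t] by (simp add: scaleR_conv_of_real)
    from this this[of "- t" for t] show ?thesis by (auto simp: ray_def b)
  qed
  then have "collinear (ray b1 \<union> ray b2)"
    by (rule collinear_subset[rotated]) (auto simp: collinear_def span_singleton
        scaleR_diff_left[symmetric])
  moreover have "confined_outside m B s p (cball 0 r') {b1, b2}" using u by (simp add: b)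
  moreover have "direction b2 = - direction b1" by (simp add: b)
  \<comment> \<open>Here \<open>b1\<close> and \<open>b2\<close> are arbitrary. Applied to this
    pair, the lemma finds \<open>u\<close> and \<open>- u\<close> among the two directions, and
    these differ because \<open>u\<close> is nonzero.\<close>
  moreover have "direction b2 = - direction b1 \<and> slope b1 = s \<and> slope b2 = s"
    if b12: "b1 \<in> bands" "b2 \<in> bands" "confined_outside m B s p (cball c r) {b1, b2}" for c r b1 b2
  proof -
    obtain u where u: "u \<in> direction ` {b1, b2}" "- u \<in> direction ` {b1, b2}" "norm u = 1"
      "\<bar>Im u / Re u\<bar> = s"
      using one_band_or_opposite_bands[OF assms(1,2) _ _ b12(3) not_single] b12(1,2) by auto
    have "u \<noteq> - u" using u(3) by auto
    then have "direction b1 = u \<and> direction b2 = - u \<or> direction b1 = - u \<and> direction b2 = u"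
      using u(1,2) by auto
    then show ?thesis using u(4) by (auto simp: slope_def)
  qed
  moreover have "card {b1, b2} \<le> 2" by (simp add: card_insert_if)
  ultimately show ?thesis
    using bands by (metis finite.emptyI finite.insertI empty_subsetI insert_subset)
qed

end
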